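(* Let $n \ge 1$ and let $A \in M_n(\mathbb{C})$ be a normal matrix. Then $$\frac{\sqrt{3}}{2}\,\Bigl\| A - \Bigl(\frac{1}{n}\mathrm{Tr}\,A\Bigr) I_n \Bigr\| \;\le\; \mathrm{spd}(A).$$ Moreover, if $A$ is Hermitian, then $$\Bigl\| A - \Bigl(\frac{1}{n}\mathrm{Tr}\,A\Bigr) I_n \Bigr\| \;\le\; \mathrm{spd}(A).$$
   Context: $M_n(\mathbb{C})$ is the algebra of $n\times n$ complex matrices, $I_n$ is the identity matrix, $\mathrm{Tr}$ is the usual (unnormalized) trace, and $\|\cdot\|$ is the operator (spectral) norm. The spread of $A$ is $\mathrm{spd}(A) = \max_{i,j} |\lambda_i(A) - \lambda_j(A)|$, where $\lambda_1(A),\dots,\lambda_n(A)$ are the eigenvalues of $A$. *)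

theory Defs
  imports "HOL-Analysis.Analysis"
begin

definition conj_transpose :: "complex^'n^'m \<Rightarrow> complex^'m^'n" where
  "conj_transpose A = (\<chi> i j. cnj (A $ j $ i))"

definition normal_matrix :: "complex^'n^'n \<Rightarrow> bool" where
  "normal_matrix A \<longleftrightarrow> A ** conj_transpose A = conj_transpose A ** A"

definition hermitian_matrix :: "complex^'n^'n \<Rightarrow> bool" where
  "hermitian_matrix A \<longleftrightarrow> conj_transpose A = A"

text \<open>The norm on \<open>complex^'n\<close> is the Euclidean (Hermitian) norm, so this is the spectral norm.\<close>
definition op_norm :: "complex^'n^'m \<Rightarrow> real" where
  "op_norm A = onorm (\<lambda>x. A *v x)"

definition eigenvalues :: "complex^'n^'n \<Rightarrow> complex set" where
  "eigenvalues A = {l. \<exists>v. v \<noteq> 0 \<and> A *v v = l *s v}"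

text \<open>The set of eigenvalues is finite and nonempty, so \<open>Max\<close> is a genuine maximum;
  multiplicities do not affect it.\<close>
definition spread :: "complex^'n^'n \<Rightarrow> real" where
  "spread A = Max {cmod (l - m) | l m. l \<in> eigenvalues A \<and> m \<in> eigenvalues A}"

end

theory Submission
  imports Defs
begin

text \<open>The proof gives the constant \<open>1\<close> for every normal matrix. A normal matrix \<open>B\<close> has an
  eigenvalue of modulus at least \<open>\<parallel>B\<parallel>\<close>. Put \<open>t = Tr A / n\<close>. Applied to \<open>A - t I\<close>, this
  gives an eigenvalue \<open>l\<close> of \<open>A\<close> with \<open>\<parallel>A - t I\<parallel> \<le> \<bar>l - t\<bar>\<close>. Now \<open>t - l\<close> is the normalised trace of
  \<open>A - l I\<close>, hence \<open>\<bar>l - t\<bar> \<le> \<parallel>A - l I\<parallel>\<close>, and, applied to \<open>A - l I\<close>, the same fact gives an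
  eigenvalue \<open>m\<close> of \<open>A\<close> with \<open>\<parallel>A - l I\<parallel> \<le> \<bar>m - l\<bar>\<close>.\<close>

section \<open>Adjoints, scalar matrices and the inner product\<close>

lemma conj_transpose_conj_transpose [simp]: "conj_transpose (conj_transpose A) = A"
  by (simp add: conj_transpose_def vec_eq_iff)

lemma conj_transpose_diff_mat:
  "conj_transpose (A - mat c) = conj_transpose A - mat (cnj c)"
  by (simp add: conj_transpose_def vec_eq_iff mat_def)

text \<open>Here \<open>inner\<close> is the real part of the Hermitian product, so a complex scalar
  cannot be pulled out of it and moves to the other argument instead.\<close>

lemma inner_complex_mult_left: "inner (a * x) y = inner x (cnj a * y)" for a x y :: complex
  by (simp add: inner_complex_def algebra_simps)

lemma inner_matrix_vector_conj_transpose: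
  fixes A :: "complex^'n^'m"
  shows "inner (A *v x) y = inner x (conj_transpose A *v y)"
proof -
  have "inner (A *v x) y = (\<Sum>i\<in>UNIV. \<Sum>j\<in>UNIV. inner (x $ j) (cnj (A $ i $ j) * y $ i))"
    by (simp add: inner_vec_def matrix_vector_mult_def inner_sum_left inner_complex_mult_left)
  also have "\<dots> = (\<Sum>j\<in>UNIV. \<Sum>i\<in>UNIV. inner (x $ j) (cnj (A $ i $ j) * y $ i))"
    by (rule sum.swap)
  also have "\<dots> = inner x (conj_transpose A *v y)"
    by (simp add: inner_vec_def matrix_vector_mult_def inner_sum_right conj_transpose_def)
  finally show ?thesis .
qed

lemma inner_vector_scalar_mult_left:
  fixes x y :: "complex^'n"
  shows "inner (c *s x) y = inner x (cnj c *s y)"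
  by (simp add: inner_vec_def inner_complex_mult_left)

lemma norm_vector_scalar_mult:
  fixes x :: "complex^'n"
  shows "norm (c *s x) = cmod c * norm x"
  by (simp add: norm_vec_def norm_mult L2_set_right_distrib)

lemma scaleR_eq_vector_scalar_mult:
  fixes x :: "complex^'n"
  shows "r *\<^sub>R x = of_real r *s x"
  unfolding vec_eq_iff vector_scaleR_component vector_smult_component
  by (simp add: scaleR_conv_of_real)

lemma mat_vector_mult:
  fixes x :: "'a::semiring_1^'n"
  shows "mat c *v x = c *s x"
  by (simp add: vec_eq_iff matrix_vector_mult_def mat_def if_distrib[of "\<lambda>u. u * _"]
      sum.delta cong: if_cong)

lemma diff_mat_vector_mult:
  fixes A :: "'a::ring_1^'n^'n"
  shows "(A - mat c) *v x = A *v x - c *s x"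
  by (simp add: matrix_vector_mult_diff_rdistrib mat_vector_mult)

section \<open>Eigenvectors of normal matrices\<close>

lemma normal_matrix_iff:
  "normal_matrix A \<longleftrightarrow> (\<forall>x. A *v (conj_transpose A *v x) = conj_transpose A *v (A *v x))"
  by (simp add: normal_matrix_def matrix_eq matrix_vector_mul_assoc)

lemma normal_matrix_diff_mat:
  assumes "normal_matrix A"
  shows "normal_matrix (A - mat c)"
  using assms
  by (simp add: normal_matrix_iff conj_transpose_diff_mat diff_mat_vector_mult
      matrix_vector_mult_diff_distrib vector_scalar_commute vector_ssub_ldistrib
      mult.commute)

lemma norm_conj_transpose_vector_mult:
  assumes "normal_matrix A"
  shows "norm (conj_transpose A *v x) = norm (A *v x)"
proof -
  have "inner (conj_transpose A *v x) (conj_transpose A *v x) = inner (A *v x) (A *v x)"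
    using assms by (simp add: inner_matrix_vector_conj_transpose normal_matrix_iff)
  then show ?thesis
    by (simp add: norm_eq_sqrt_inner)
qed

text \<open>The matrix \<open>A - mat l\<close> is again normal, so it and its adjoint have the same
  kernel.\<close>

lemma normal_matrix_eigenvector_conj_transpose:
  assumes "normal_matrix A" "A *v v = l *s v"
  shows "conj_transpose A *v v = cnj l *s v"
proof -
  have "norm (conj_transpose (A - mat l) *v v) = 0"
    using assms(2) norm_conj_transpose_vector_mult[OF normal_matrix_diff_mat[OF assms(1)]]
    by (simp add: diff_mat_vector_mult)
  then show ?thesis
    by (simp add: conj_transpose_diff_mat diff_mat_vector_mult)
qed

lemma normal_matrix_eigenvectors_orthogonal:
  assumes "normal_matrix A" "A *v v = l *s v" "A *v w = m *s w" "l \<noteq> m"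
  shows "orthogonal v w"
proof -
  \<comment> \<open>A real inner product does not allow cancelling the complex factor
    \<open>l - m\<close>. Dividing \<open>v\<close> by it beforehand gives an eigenvector
    \<open>u\<close> with \<open>l *s u - m *s u = v\<close>.\<close>
  define u where "u = inverse (l - m) *s v"
  have "A *v u = l *s u"
    using assms(2) by (simp add: u_def vector_scalar_commute mult.commute)
  then have "inner (l *s u) w = inner (m *s u) w"
    using inner_matrix_vector_conj_transpose[of A u w]
      normal_matrix_eigenvector_conj_transpose[OF assms(1,3)]
    by (simp add: inner_vector_scalar_mult_left)
  moreover have "v = l *s u - m *s u"
    using assms(4) by (simp add: u_def vec_eq_iff divide_simps) (simp add: algebra_simps)
  ultimately show ?thesis
    by (simp add: orthogonal_def inner_diff_left)
qed

text \<open>Eigenvectors chosen for distinct eigenvalues are nonzero and pairwise orthogonal, hence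
  independent over the reals in a finite-dimensional space. Finiteness makes the \<open>Max\<close>
  in \<open>spread\<close> an upper bound.\<close>

lemma finite_eigenvalues_normal_matrix:
  assumes "normal_matrix A"
  shows "finite (eigenvalues A)"
proof -
  have "\<forall>l\<in>eigenvalues A. \<exists>v. v \<noteq> 0 \<and> A *v v = l *s v"
    by (simp add: eigenvalues_def)
  then obtain f where f: "\<And>l. l \<in> eigenvalues A \<Longrightarrow> f l \<noteq> 0 \<and> A *v f l = l *s f l"
    by metis
  have "orthogonal (f l) (f m)" if "l \<in> eigenvalues A" "m \<in> eigenvalues A" "l \<noteq> m" for l m
    using that f normal_matrix_eigenvectors_orthogonal[OF assms] by blast
  then have "pairwise orthogonal (f ` eigenvalues A)" and inj: "inj_on f (eigenvalues A)"
    using f by (fastforce simp: pairwise_def, metis inj_onI orthogonal_self)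
  then have "independent (f ` eigenvalues A)"
    using f by (intro pairwise_orthogonal_independent) auto
  then show ?thesis
    using inj finiteI_independent finite_imageD by blast
qed

text \<open>If \<open>x\<close> maximises \<open>\<parallel>A x\<parallel>\<close> on the unit sphere of \<open>E\<close> with maximum \<open>s\<close>, then expanding
  \<open>\<parallel>A\<^sup>* A x - s\<^sup>2 x\<parallel>\<^sup>2\<close> shows that it is at most \<open>s\<^sup>4 - 2 s\<^sup>4 + s\<^sup>4 = 0\<close>.\<close>
lemma normal_matrix_singular_vector:
  fixes A :: "complex^'n^'n"
  assumes A: "normal_matrix A" and E: "subspace E"
    and inv: "\<And>x. x \<in> E \<Longrightarrow> A *v x \<in> E" and ne: "y \<in> E" "y \<noteq> 0"
  obtains x s where "x \<in> E" "x \<noteq> 0" "0 \<le> s"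
    "conj_transpose A *v (A *v x) = s\<^sup>2 *\<^sub>R x"
    "\<And>z. z \<in> E \<Longrightarrow> norm (A *v z) \<le> s * norm z"
proof -
  let ?S = "sphere 0 1 \<inter> E"
  have "compact ?S"
    using closed_subspace[OF E] by (simp add: compact_Int_closed)
  moreover have "y /\<^sub>R norm y \<in> ?S"
    using ne E by (simp add: subspace_scale)
  moreover have "continuous_on ?S (\<lambda>x. norm (A *v x))"
    by (intro continuous_intros matrix_vector_mult_linear_continuous_on)
  ultimately obtain x where x: "x \<in> ?S" and max: "\<And>z. z \<in> ?S \<Longrightarrow> norm (A *v z) \<le> norm (A *v x)"
    using continuous_attains_sup[of ?S "\<lambda>x. norm (A *v x)"] by blast
  define s where "s = norm (A *v x)"
  have bound: "norm (A *v z) \<le> s * norm z" if "z \<in> E" for z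
  proof (cases "z = 0")
    case False
    then have "norm (A *v (z /\<^sub>R norm z)) \<le> s"
      unfolding s_def using that E by (intro max) (simp add: subspace_scale)
    moreover have "A *v (z /\<^sub>R norm z) = (A *v z) /\<^sub>R norm z"
      by (simp only: scaleR_eq_vector_scalar_mult vector_scalar_commute)
    ultimately show ?thesis
      using False by (simp add: field_simps)
  qed simp
  let ?w = "conj_transpose A *v (A *v x)"
  \<comment> \<open>Normality replaces the adjoint by \<open>A\<close> in the norm, and
    \<open>A *v x\<close> stays in \<open>E\<close>, where \<open>s\<close> bounds the
    growth.\<close>
  have "norm ?w \<le> s * s"
    using bound[of "A *v x"] inv x norm_conj_transpose_vector_mult[OF A]
    by (simp add: s_def)
  then have "(norm ?w)\<^sup>2 \<le> (s * s)\<^sup>2"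
    by (simp add: power_mono)
  moreover have "inner ?w x = s\<^sup>2"
    using inner_matrix_vector_conj_transpose[of A x "A *v x"]
    by (simp add: s_def inner_commute power2_norm_eq_inner)
  moreover have "inner x x = 1"
    using x by (simp add: flip: power2_norm_eq_inner)
  ultimately have "inner (?w - s\<^sup>2 *\<^sub>R x) (?w - s\<^sup>2 *\<^sub>R x) \<le> 0"
    by (simp add: inner_diff_left inner_diff_right inner_commute power2_norm_eq_inner)
      (simp add: power2_eq_square power4_eq_xxxx)
  then have "?w = s\<^sup>2 *\<^sub>R x"
    by (metis eq_iff_diff_eq_0 inner_eq_zero_iff inner_ge_zero order_antisym)
  with x bound show ?thesis
    by (intro that[of x s]) (auto simp: s_def)
qed

text \<open>On the eigenspace \<open>E\<close> of \<open>A\<^sup>* A\<close> for \<open>s\<^sup>2\<close>, where \<open>s = \<parallel>A\<parallel>\<close>, a singular vector of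
  \<open>A + s I\<close> is an eigenvector of \<open>A + A\<^sup>*\<close>, hence is annihilated by a quadratic
  polynomial in \<open>A\<close>. Splitting that polynomial gives an eigenvector of \<open>A\<close> in \<open>E\<close>.\<close>
lemma normal_matrix_op_norm_le_eigenvalue:
  fixes A :: "complex^'n^'n"
  assumes A: "normal_matrix A"
  obtains l where "l \<in> eigenvalues A" "op_norm A \<le> cmod l"
proof -
  note result = that
  let ?T = "conj_transpose A"
  have comm: "A *v (?T *v x) = ?T *v (A *v x)" for x
    using A by (simp add: normal_matrix_iff)
  have "axis undefined 1 \<noteq> (0 :: complex^'n)"
    by (simp add: axis_eq_0_iff)
  then obtain x0 s where x0: "x0 \<noteq> 0" and s: "0 \<le> s"
      and x0s: "?T *v (A *v x0) = s\<^sup>2 *\<^sub>R x0"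
      and bound: "\<And>z. norm (A *v z) \<le> s * norm z"
    using normal_matrix_singular_vector[OF A subspace_UNIV] by (metis UNIV_I)
  have "op_norm A \<le> s"
    unfolding op_norm_def using bound by (rule onorm_le)
  define E where "E = {x. ?T *v (A *v x) = of_real (s\<^sup>2) *s x}"
  \<comment> \<open>\<open>A\<close> commutes with its adjoint, hence preserves every eigenspace of
    their product.\<close>
  have E_A: "A *v x \<in> E" if "x \<in> E" for x
    using that comm[of "A *v x"] by (simp add: E_def vector_scalar_commute flip: comm)
  have E_scale: "c *s x \<in> E" if "x \<in> E" for x c
    using that by (simp add: E_def vector_scalar_commute mult.commute)
  have E_sub: "subspace E"
    unfolding subspace_def
    using E_scale by (auto simp: scaleR_eq_vector_scalar_mult E_def vec.add vector_add_ldistrib)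
  have x0E: "x0 \<in> E"
    using x0s by (simp add: E_def scaleR_eq_vector_scalar_mult)
  \<comment> \<open>Every eigenvector in \<open>E\<close> will do: on \<open>E\<close> the matrix
    \<open>A\<close> scales norms by exactly \<open>s\<close>, so its eigenvalue has modulus
    \<open>s\<close>.\<close>
  have eig: thesis if v: "v \<in> E" "v \<noteq> 0" "A *v v = l *s v" for v l
  proof (rule result)
    show "l \<in> eigenvalues A"
      using v by (auto simp: eigenvalues_def)
    have "(norm (A *v v))\<^sup>2 = inner v (s\<^sup>2 *\<^sub>R v)"
      using v(1) inner_matrix_vector_conj_transpose[of A v "A *v v"]
      by (simp add: E_def power2_norm_eq_inner scaleR_eq_vector_scalar_mult)
    then have "(cmod l * norm v)\<^sup>2 = (s * norm v)\<^sup>2"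
      using v(3) by (simp add: norm_vector_scalar_mult power_mult_distrib power2_norm_eq_inner)
    then have "cmod l = s"
      using v(2) s by (simp add: power2_eq_iff_nonneg)
    then show "op_norm A \<le> cmod l"
      using \<open>op_norm A \<le> s\<close> by simp
  qed
  show thesis
  proof (cases "s = 0")
    case True
    then show thesis
      using eig[of x0 0] bound[of x0] x0 x0E by simp
  next
    case False
    let ?M = "A - mat (- of_real s)"
    have "?M *v x \<in> E" if "x \<in> E" for x
      using that E_A E_scale E_sub by (simp add: diff_mat_vector_mult subspace_add)
    then obtain x r where x: "x \<in> E" "x \<noteq> 0"
        and r: "conj_transpose ?M *v (?M *v x) = r\<^sup>2 *\<^sub>R x"
      using normal_matrix_singular_vector[OF normal_matrix_diff_mat[OF A] E_sub _ x0E x0]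
      by metis
    \<comment> \<open>Expanding the product of \<open>?M\<close> and its adjoint at
      \<open>x\<close>, the two outer terms each give \<open>s\<^sup>2\<close> times
      \<open>x\<close>; solving for the middle terms gives \<open>c\<close>.\<close>
    define c :: complex where "c = (of_real (r\<^sup>2) - 2 * of_real (s\<^sup>2)) / of_real s"
    have c: "of_real s * c = of_real (r\<^sup>2) - 2 * of_real (s\<^sup>2)"
      using False by (simp add: c_def)
    have "?T *v (A *v x) + of_real s *s (?T *v x) + of_real s *s (A *v x) + of_real (s\<^sup>2) *s x =
        conj_transpose ?M *v (?M *v x)"
      by (simp add: conj_transpose_diff_mat diff_mat_vector_mult vec.add vector_scalar_commute
          vector_add_ldistrib power2_eq_square)
    then have "of_real s *s (?T *v x + A *v x) = (of_real (r\<^sup>2) - 2 * of_real (s\<^sup>2)) *s x"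
      using x(1) unfolding r E_def scaleR_eq_vector_scalar_mult
      by (simp add: vec_eq_iff ring_distribs) (simp add: algebra_simps)
    then have "of_real s *s (?T *v x + A *v x) = of_real s *s (c *s x)"
      by (simp add: c)
    then have "?T *v x + A *v x = c *s x"
      using False by (simp only: vector_mul_lcancel of_real_eq_0_iff simp_thms)
    then have "A *v (?T *v x + A *v x) = A *v (c *s x)"
      by simp
    then have quad: "A *v (A *v x) = c *s (A *v x) - of_real (s\<^sup>2) *s x"
      using x(1) by (simp add: E_def vec.add vector_scalar_commute comm algebra_simps)
    \<comment> \<open>\<open>a\<close> and \<open>b\<close> are the roots of the polynomial with sum
      \<open>c\<close> and product \<open>s\<^sup>2\<close> that annihilates
      \<open>x\<close>.\<close>
    define d where "d = csqrt (c\<^sup>2 - 4 * of_real (s\<^sup>2))"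
    define a where "a = (c + d) / 2"
    define b where "b = (c - d) / 2"
    have ab: "c = a + b" "of_real (s\<^sup>2) = a * b"
    proof -
      have "d * d = c\<^sup>2 - 4 * of_real (s\<^sup>2)"
        unfolding d_def by (metis power2_csqrt power2_eq_square)
      then show "of_real (s\<^sup>2) = a * b"
        by (simp add: a_def b_def field_simps power2_eq_square)
    qed (simp add: a_def b_def field_simps)
    \<comment> \<open>Since \<open>A - mat a\<close> kills \<open>y\<close>, either \<open>y\<close>
      is an eigenvector for \<open>a\<close>, or \<open>y = 0\<close> and \<open>x\<close> is one
      for \<open>b\<close>.\<close>
    define y where "y = A *v x - b *s x"
    have "A *v y = a *s y"
      unfolding y_def vec.diff vector_scalar_commute quad ab
      by (simp add: vec_eq_iff algebra_simps)
    moreover have "y \<in> E"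
      unfolding y_def using x E_A E_scale E_sub by (simp add: subspace_diff)
    ultimately show thesis
      using eig[of y a] eig[of x b] x by (cases "y = 0") (auto simp: y_def)
  qed
qed

section \<open>Shifted matrices, trace and spread\<close>

lemma normal_matrix_op_norm_diff_mat_le:
  assumes "normal_matrix A"
  obtains l where "l \<in> eigenvalues A" "op_norm (A - mat c) \<le> cmod (l - c)"
proof -
  obtain k where k: "k \<in> eigenvalues (A - mat c)" "op_norm (A - mat c) \<le> cmod k"
    using normal_matrix_op_norm_le_eigenvalue[OF normal_matrix_diff_mat[OF assms]] .
  then have "k + c \<in> eigenvalues A"
    by (auto simp: eigenvalues_def diff_mat_vector_mult vector_sadd_rdistrib diff_eq_eq)
  with k show thesis
    by (intro that[of "k + c"]) auto
qed

lemma bounded_linear_matrix_vector_mult: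
  fixes A :: "complex^'n^'m"
  shows "bounded_linear (\<lambda>x. A *v x)"
  by (intro linear_conv_bounded_linear[THEN iffD1] linearI)
    (simp_all add: vec.add scaleR_eq_vector_scalar_mult vector_scalar_commute)

text \<open>Each diagonal entry is a coordinate of the image of a unit basis vector.\<close>

lemma norm_trace_le_op_norm:
  fixes A :: "complex^'n^'n"
  shows "cmod (trace A) \<le> real CARD('n) * op_norm A"
proof -
  have "cmod (A $ i $ i) \<le> op_norm A" for i
  proof -
    have "cmod (A $ i $ i) = cmod ((A *v axis i 1) $ i)"
      by (simp add: matrix_vector_mult_def axis_def if_distrib[of "\<lambda>u. _ * u"] cong: if_cong)
    also have "\<dots> \<le> norm (A *v axis i 1)"
      by (rule Finite_Cartesian_Product.norm_nth_le)
    also have "\<dots> \<le> op_norm A * norm (axis i 1 :: complex^'n)"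
      unfolding op_norm_def by (rule onorm[OF bounded_linear_matrix_vector_mult])
    finally show ?thesis
      by simp
  qed
  then show ?thesis
    unfolding trace_def using sum_norm_le[of UNIV "\<lambda>i. A $ i $ i" "\<lambda>_. op_norm A"] by simp
qed

lemma normal_matrix_dist_le_spread:
  assumes "normal_matrix A" "l \<in> eigenvalues A" "m \<in> eigenvalues A"
  shows "cmod (l - m) \<le> spread A"
proof -
  have "{cmod (l - m) | l m. l \<in> eigenvalues A \<and> m \<in> eigenvalues A} =
      (\<lambda>(l, m). cmod (l - m)) ` (eigenvalues A \<times> eigenvalues A)"
    by auto
  then show ?thesis
    unfolding spread_def using assms finite_eigenvalues_normal_matrix[OF assms(1)]
    by (intro Max_ge) auto
qed

lemma normal_matrix_op_norm_le_spread:
  fixes A :: "complex^'n^'n"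
  assumes A: "normal_matrix A"
  shows "op_norm (A - mat (trace A / of_nat CARD('n))) \<le> spread A"
proof -
  define t where "t = trace A / of_nat CARD('n)"
  obtain l where l: "l \<in> eigenvalues A" "op_norm (A - mat t) \<le> cmod (l - t)"
    using normal_matrix_op_norm_diff_mat_le[OF A] .
  obtain m where m: "m \<in> eigenvalues A" "op_norm (A - mat l) \<le> cmod (m - l)"
    using normal_matrix_op_norm_diff_mat_le[OF A] .
  have "trace (A - mat l) = of_nat CARD('n) * (t - l)"
    by (simp add: t_def trace_sub trace_def mat_def sum_subtractf algebra_simps)
  then have "real CARD('n) * cmod (l - t) \<le> real CARD('n) * op_norm (A - mat l)"
    using norm_trace_le_op_norm[of "A - mat l"] by (simp add: norm_mult norm_minus_commute)
  then have "cmod (l - t) \<le> op_norm (A - mat l)"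
    by simp
  then show ?thesis
    using l m normal_matrix_dist_le_spread[OF A m(1) l(1)] by (simp add: t_def)
qed

theorem corollary2:
  fixes A :: "complex^'n^'n"
  assumes "normal_matrix A"
  shows "sqrt 3 / 2 * op_norm (A - mat (trace A / of_nat CARD('n))) \<le> spread A \<and>
         (hermitian_matrix A \<longrightarrow> op_norm (A - mat (trace A / of_nat CARD('n))) \<le> spread A)"
proof -
  let ?B = "A - mat (trace A / of_nat CARD('n))"
  have "sqrt 3 \<le> 2"
    by (rule real_le_lsqrt) simp_all
  moreover have "0 \<le> op_norm ?B"
    unfolding op_norm_def by (rule onorm_pos_le[OF bounded_linear_matrix_vector_mult])
  ultimately have "sqrt 3 / 2 * op_norm ?B \<le> 1 * op_norm ?B"
    by (intro mult_right_mono) simp_all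
  then show ?thesis
    using normal_matrix_op_norm_le_spread[OF assms] by simp
qed

end
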